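(* Let $q$ be a prime power and let $n,r$ be positive integers with $r\ge 2$. Let $L_U$ be a maximum $(r-1)$-scattered $\mathbb{F}_q$-linear set in $\Lambda=\mathrm{PG}(r-1,q^n)$ and let $N=|L_U|=\frac{q^n-1}{q-1}$. Then $\mathcal{C}_{L_U}$ is an $r$-weight code, with weights $$w_i=N-\theta_{i-1},\qquad i\in\{0,\ldots,r-1\}.$$ Its weight enumerator is $$1+\sum_{i=0}^{r-1}A_{n-i}\,z^{w_i},$$ where, with $d=n-r+1$, for $\ell\in\{0,1,\ldots,n-d\}$, $$A_{d+\ell}={n \brack d+\ell}_q\sum_{t=0}^{\ell}(-1)^{t-\ell}{\ell+d \brack \ell-t}_q q^{\binom{\ell-t}{2}}\bigl(q^{n(t+1)}-1\bigr).$$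
   Context: Notation: $\theta_i=\frac{q^{i+1}-1}{q-1}$ for $i\ge 0$, $\theta_{-1}=0$; ${a\brack b}_q$ denotes the Gaussian ($q$-)binomial coefficient. Linear sets: Let $V$ be an $r$-dimensional $\mathbb{F}_{q^n}$-vector space and $\Lambda=\mathrm{PG}(V,\mathbb{F}_{q^n})=\mathrm{PG}(r-1,q^n)$. An $\mathbb{F}_q$-linear set of rank $k$ in $\Lambda$ is a point set $L_U=\{\langle u\rangle_{\mathbb{F}_{q^n}} : u\in U\setminus\{0\}\}$, where $U$ is a $k$-dimensional $\mathbb{F}_q$-subspace of $V$. For a projective subspace $\Omega=\mathrm{PG}(W,\mathbb{F}_{q^n})$ of $\Lambda$, its weight in $L_U$ is $w_{L_U}(\Omega)=\dim_{\mathbb{F}_q}(W\cap U)$. $L_U$ is $h$-scattered if $\langle L_U\rangle=\Lambda$ and every $(h-1)$-dimensional projective subspace $\Omega$ of $\Lambda$ satisfies $w_{L_U}(\Omega)\le h$. A maximum $h$-scattered linear set is an $h$-scattered $\mathbb{F}_q$-linear set of rank $\frac{rn}{h+1}$; for $h=r-1$ the rank is $n$. Code: Write $L_U=\{\langle (g_{1i},\ldots,g_{ri})\rangle_{\mathbb{F}_{q^n}} : i\in\{1,\ldots,N\}\}$ with $N=|L_U|$ (one representative vector per point). $\mathcal{C}_{L_U}$ is the $\mathbb{F}_{q^n}$-linear code of length $N$ and dimension $r$ whose generator matrix is the $(r\times N)$-matrix having these vectors as columns. An $\ell$-weight code is a linear code whose nonzero codewords have exactly $\ell$ distinct Hamming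 weights. The weight enumerator of a code of length $m$ is $1+\sum_{i=1}^m A_i^H z^i$, where $A_i^H$ is the number of codewords of Hamming weight $i$. *)

theory Defs
  imports "HOL-Analysis.Analysis" "HOL-Computational_Algebra.Polynomial"
begin

section \<open>The numbers \<open>\<theta>\<^sub>i\<close> and the Gaussian binomial coefficients\<close>

(* Number of points of PG(i,q). The division is exact; the index is an integer so that
   theta q (-1) = 0 can be stated literally. *)
definition theta :: "nat \<Rightarrow> int \<Rightarrow> nat" where
  "theta q i = (if i < 0 then 0 else (q ^ (nat i + 1) - 1) div (q - 1))"

(* For b > a the factor with i = a vanishes, so the coefficient is 0, as it should be. *)
definition gauss_binomial :: "nat \<Rightarrow> nat \<Rightarrow> nat \<Rightarrow> real" where
  "gauss_binomial q a b = (\<Prod>i<b. (real q ^ (a - i) - 1) / (real q ^ (i + 1) - 1))"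

section \<open>Linear sets\<close>

(* The field extension GF(q^n) / GF(q) is an embedding of a finite field 'k into a finite
   field 'f; the underlying vector space of PG(r-1,q^n) is 'f ^ 'r. *)
definition field_embedding :: "('k::field \<Rightarrow> 'f::field) \<Rightarrow> bool" where
  "field_embedding emb \<longleftrightarrow>
     emb 1 = 1 \<and> (\<forall>x y. emb (x + y) = emb x + emb y) \<and> (\<forall>x y. emb (x * y) = emb x * emb y)"

definition restrict_scale :: "('k::field \<Rightarrow> 'f::field) \<Rightarrow> 'k \<Rightarrow> 'f ^ 'r \<Rightarrow> 'f ^ 'r" where
  "restrict_scale emb c v = emb c *s v"

lemma vector_space_restrict_scale:
  assumes "field_embedding emb"
  shows "vector_space (restrict_scale emb :: 'k::field \<Rightarrow> 'f::field ^ 'r \<Rightarrow> _)"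
  using assms unfolding field_embedding_def restrict_scale_def
  by unfold_locales (auto simp: vec.scale_right_distrib vec.scale_left_distrib)

abbreviation sub_subspace :: "('k::field \<Rightarrow> 'f::field) \<Rightarrow> ('f ^ 'r) set \<Rightarrow> bool" where
  "sub_subspace emb \<equiv> module.subspace (restrict_scale emb)"

abbreviation sub_dim :: "('k::field \<Rightarrow> 'f::field) \<Rightarrow> ('f ^ 'r) set \<Rightarrow> nat" where
  "sub_dim emb \<equiv> vector_space.dim (restrict_scale emb)"

(* Projective points are one-dimensional 'f-subspaces. *)
definition linear_set :: "('f::field ^ 'r) set \<Rightarrow> ('f ^ 'r) set set" where
  "linear_set U = (\<lambda>u. vec.span {u}) ` (U - {0})"

definition weight :: "('k::field \<Rightarrow> 'f::field) \<Rightarrow> ('f ^ 'r) set \<Rightarrow> ('f ^ 'r) set \<Rightarrow> nat" where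
  "weight emb U W = sub_dim emb (W \<inter> U)"

(* An (h-1)-dimensional projective subspace is PG(W) with W of vector space dimension h. *)
definition h_scattered ::
    "('k::field \<Rightarrow> 'f::field) \<Rightarrow> nat \<Rightarrow> ('f ^ 'r) set \<Rightarrow> bool" where
  "h_scattered emb h U \<longleftrightarrow>
     sub_subspace emb U \<and>
     vec.span (\<Union>(linear_set U)) = UNIV \<and>
     (\<forall>W. vec.subspace W \<and> vec.dim W = h \<longrightarrow> weight emb U W \<le> h)"

(* The second condition says that the rank of the linear set is r n / (h + 1), where n is
   the degree of the field extension. *)
definition maximum_h_scattered ::
    "('k::field \<Rightarrow> 'f::field) \<Rightarrow> nat \<Rightarrow> nat \<Rightarrow> ('f ^ 'r) set \<Rightarrow> bool" where
  "maximum_h_scattered emb n h U \<longleftrightarrow>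
     h_scattered emb h U \<and> (h + 1) * sub_dim emb U = CARD('r) * n"

section \<open>Linear codes\<close>

definition hamming_weight :: "'f::zero ^ 'm \<Rightarrow> nat" where
  "hamming_weight c = card {i. c $ i \<noteq> 0}"

definition nonzero_weights :: "('f::zero ^ 'm) set \<Rightarrow> nat set" where
  "nonzero_weights C = hamming_weight ` (C - {0})"

definition weight_code :: "nat \<Rightarrow> ('f::field ^ 'm) set \<Rightarrow> bool" where
  "weight_code l C \<longleftrightarrow> vec.subspace C \<and> card (nonzero_weights C) = l"

definition weight_enumerator :: "('f::field ^ 'm) set \<Rightarrow> real poly" where
  "weight_enumerator C =
     1 + (\<Sum>i = 1..CARD('m). monom (real (card {c \<in> C. hamming_weight c = i})) i)"

definition generated_code :: "'f::field ^ 'm ^ 'r \<Rightarrow> ('f ^ 'm) set" where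
  "generated_code G = vec.span (rows G)"

(* The columns of G are representative vectors, exactly one for each point of L. In
   particular the index type 'm of the columns has as many elements as L. *)
definition represents_points :: "'f::field ^ 'm ^ 'r \<Rightarrow> ('f ^ 'r) set set \<Rightarrow> bool" where
  "represents_points G L \<longleftrightarrow> bij_betw (\<lambda>i. vec.span {column i G}) UNIV L"

(* G is a generator matrix in the strict sense: its rows are linearly independent as soon as
   the point set spans the whole space. *)
lemma dim_generated_code:
  fixes G :: "'f::field ^ 'm ^ 'r"
  assumes "represents_points G L" "vec.span (\<Union>L) = UNIV"
  shows "vec.dim (generated_code G) = CARD('r)"
proof -
  have L: "L = range (\<lambda>i. vec.span {column i G})"
    using assms(1) unfolding represents_points_def bij_betw_def by simp
  have "vec.span {column i G} \<subseteq> vec.span (columns G)" for i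
    by (rule vec.span_mono) (auto simp: columns_def)
  then have le: "\<Union>L \<subseteq> vec.span (columns G)"
    unfolding L by blast
  have "vec.span (\<Union>L) \<subseteq> vec.span (columns G)"
    using le vec.subspace_span by (rule vec.span_minimal)
  then have "vec.span (columns G) = UNIV"
    using assms(2) by auto
  then have "\<exists>B. G ** B = mat 1"
    by (simp add: matrix_right_invertible_span_columns)
  then have *: "\<And>c. (\<Sum>i\<in>UNIV. c i *s row i G) = 0 \<Longrightarrow> \<forall>i. c i = 0"
    by (simp add: matrix_right_invertible_independent_rows)
  have inj: "inj (\<lambda>i. row i G)"
  proof (rule injI, rule ccontr)
    fix i j assume ij: "row i G = row j G" "i \<noteq> j"
    let ?c = "\<lambda>k. if k = i then 1 else if k = j then - 1 else (0::'f)"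
    have "(\<Sum>k\<in>UNIV. ?c k *s row k G) = (\<Sum>k\<in>{i, j}. ?c k *s row k G)"
      by (rule sum.mono_neutral_right) auto
    also have "\<dots> = 0" using ij by simp
    finally show False using *[of ?c] by (metis zero_neq_one)
  qed
  have rows: "rows G = range (\<lambda>i. row i G)" by (auto simp: rows_def)
  then have fin: "finite (rows G)" by simp
  have "vec.independent (rows G)"
    unfolding vec.dependent_finite[OF fin]
  proof safe
    fix u v assume v: "v \<in> rows G" "u v \<noteq> 0" and s: "(\<Sum>v\<in>rows G. u v *s v) = 0"
    have "(\<Sum>i\<in>UNIV. u (row i G) *s row i G) = 0"
      using s unfolding rows by (simp add: sum.reindex[OF inj])
    from *[OF this] v show False by (auto simp: rows_def)
  qed
  then have "vec.dim (rows G) = card (rows G)"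
    by (rule vec.dim_eq_card_independent)
  then show ?thesis
    by (simp add: generated_code_def rows card_image[OF inj])
qed

end

theory Submission
  imports Defs
begin

text \<open>
  The codeword of a coordinate vector \<open>a\<close> has, at a point \<open>\<langle>u\<rangle>\<close> of the linear set, the entry \<open>a \<cdot> u\<close> up
  to a nonzero factor. Its Hamming weight is therefore the number of points outside the hyperplane
  \<open>a\<^sup>\<bottom>\<close>. Every point of the linear set comes from \<open>q - 1\<close> vectors of \<open>U\<close>, so if \<open>U\<close> meets the
  hyperplane in dimension \<open>i\<close> over the small field, then it contains \<open>\<theta>\<^bsub>i - 1\<^esub>\<close> of the points
  (\<open>hamming_weight_codeword\<close>). What has to be found is the distribution of
  \<open>i = dim (U \<inter> a\<^sup>\<bottom>)\<close> over all nonzero \<open>a\<close>.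

  The scattering hypothesis says that any at most \<open>r\<close> vectors of \<open>U\<close> that are independent over the small
  field stay independent over the large field (\<open>independent_lift\<close>). Hence exactly \<open>q ^ (n * (r - t))\<close>
  vectors \<open>a\<close> annihilate a given \<open>t\<close>-dimensional subspace of \<open>U\<close>, for every \<open>t \<le> r\<close>: the maps
  \<open>u \<mapsto> a \<cdot> u\<close> on \<open>U\<close> form a maximum rank distance code. Two consequences finish the proof.

  A union bound over the vectors of \<open>U\<close> outside a fixed \<open>i\<close>-dimensional subspace shows that each
  dimension \<open>i < r\<close> occurs (\<open>kernel_dim_attained\<close>), so that there are exactly \<open>r\<close> weights.

  Counting the pairs of a nonzero \<open>a\<close> and an independent \<open>t\<close>-tuple in \<open>U \<inter> a\<^sup>\<bottom>\<close> in two ways yields the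
  \<open>q\<close>-binomial moments of the distribution for all \<open>t < r\<close> (\<open>kernel_count_moments\<close>), and Gaussian
  inversion (\<open>gauss_binomial_inversion\<close>) converts them into the numbers \<open>A\<close> (\<open>kernel_count_formula\<close>).
\<close>

section \<open>Gaussian binomial inversion\<close>

definition q_factorial :: "nat \<Rightarrow> nat \<Rightarrow> real" where
  "q_factorial q m = (\<Prod>i<m. real q ^ (i + 1) - 1)"

lemma q_factorial_0 [simp]: "q_factorial q 0 = 1"
  by (simp add: q_factorial_def)

lemma q_factorial_Suc: "q_factorial q (Suc m) = q_factorial q m * (real q ^ Suc m - 1)"
  by (simp add: q_factorial_def)

lemma q_power_neq_1: "q > 1 \<Longrightarrow> real q * real q ^ i \<noteq> 1"
  using power_eq_1_iff[of "real q" "Suc i"] one_less_power[of "real q" "Suc i"] by simp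

lemma q_factorial_nonzero: "q > 1 \<Longrightarrow> q_factorial q m \<noteq> 0"
  using q_power_neq_1[of q] by (auto simp: q_factorial_def)

lemma gauss_binomial_eq_0: "a < b \<Longrightarrow> gauss_binomial q a b = 0"
  unfolding gauss_binomial_def by (intro prod_zero bexI[of _ a]) auto

lemma gauss_binomial_0 [simp]: "gauss_binomial q a 0 = 1"
  by (simp add: gauss_binomial_def)

lemma gauss_binomial_q_factorial:
  assumes "q > 1" "b \<le> a"
  shows "gauss_binomial q a b = q_factorial q a / (q_factorial q b * q_factorial q (a - b))"
  using assms(2)
proof (induction b)
  case 0
  then show ?case using q_factorial_nonzero[OF assms(1)] by simp
next
  case (Suc b)
  then have e: "a - b = Suc (a - Suc b)" by simp
  have "gauss_binomial q a (Suc b)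
      = gauss_binomial q a b * ((real q ^ (a - b) - 1) / (real q ^ (b + 1) - 1))"
    by (simp add: gauss_binomial_def)
  also have "\<dots> = q_factorial q a * (real q ^ Suc (a - Suc b) - 1)
      / (q_factorial q b * (q_factorial q (a - Suc b) * (real q ^ Suc (a - Suc b) - 1))
         * (real q ^ Suc b - 1))"
    using Suc by (simp add: e q_factorial_Suc)
  also have "\<dots> = q_factorial q a / (q_factorial q (Suc b) * q_factorial q (a - Suc b))"
    using q_power_neq_1[OF assms(1)] by (simp add: q_factorial_Suc divide_simps)
  finally show ?case .
qed

lemma gauss_binomial_symmetric:
  "q > 1 \<Longrightarrow> b \<le> a \<Longrightarrow> gauss_binomial q a (a - b) = gauss_binomial q a b"
  by (simp add: gauss_binomial_q_factorial mult.commute)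

lemma gauss_binomial_trinomial:
  assumes "q > 1" "i \<le> t" "t \<le> n"
  shows "gauss_binomial q n t * gauss_binomial q t i
       = gauss_binomial q n i * gauss_binomial q (n - i) (t - i)"
  using assms q_factorial_nonzero[OF assms(1)]
  by (simp add: gauss_binomial_q_factorial divide_simps)

text \<open>
  This form of the \<open>q\<close>-Pascal rule, with the power of \<open>q\<close> on the second summand, is the one that
  makes the alternating sum below telescope: multiplying by \<open>q ^ (s choose 2)\<close> turns the factor
  \<open>q ^ s\<close> into \<open>q ^ (Suc s choose 2)\<close>.
\<close>
lemma gauss_binomial_Suc_Suc:
  assumes "q > 1"
  shows "gauss_binomial q (Suc m) (Suc k)
       = gauss_binomial q m k + real q ^ Suc k * gauss_binomial q m (Suc k)"
proof (cases "k < m")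
  case True
  then obtain j where m: "m = Suc (k + j)" using less_iff_Suc_add by auto
  have nz: "real q ^ Suc i - 1 \<noteq> 0" for i using q_power_neq_1[OF assms] by simp
  define x y where "x = real q ^ Suc k" and "y = real q ^ Suc j"
  have nzxy: "x - 1 \<noteq> 0" "y - 1 \<noteq> 0" unfolding x_def y_def by (rule nz)+
  have xy: "real q ^ Suc m = x * y" by (simp add: m x_def y_def power_add mult_ac)
  have fm: "q_factorial q (Suc m) = q_factorial q m * (x * y - 1)"
    by (simp add: q_factorial_Suc flip: xy)
  have fk: "q_factorial q (Suc k) = q_factorial q k * (x - 1)"
    and fj: "q_factorial q (Suc j) = q_factorial q j * (y - 1)"
    by (simp_all add: q_factorial_Suc x_def y_def)
  have diffs: "Suc m - Suc k = Suc j" "m - k = Suc j" "m - Suc k = j" using m by simp_all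
  define P where "P = q_factorial q k * q_factorial q j"
  have P: "P \<noteq> 0" using q_factorial_nonzero[OF assms] by (simp add: P_def)
  have "gauss_binomial q (Suc m) (Suc k) = q_factorial q m * (x * y - 1) / (P * (x - 1) * (y - 1))"
    using True by (simp add: gauss_binomial_q_factorial[OF assms] fm fk fj diffs P_def mult_ac)
  moreover have "gauss_binomial q m k = q_factorial q m / (P * (y - 1))"
    using True by (simp add: gauss_binomial_q_factorial[OF assms] fj diffs P_def mult_ac)
  moreover have "gauss_binomial q m (Suc k) = q_factorial q m / (P * (x - 1))"
    using True by (simp add: gauss_binomial_q_factorial[OF assms] fk diffs P_def mult_ac)
  moreover have "q_factorial q m * (x * y - 1) / (P * (x - 1) * (y - 1))
     = q_factorial q m / (P * (y - 1)) + x * (q_factorial q m / (P * (x - 1)))"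
    using nzxy P by (simp add: divide_simps) (simp add: algebra_simps)
  ultimately show ?thesis by (simp add: x_def)
next
  case False
  then have "k = m \<or> m < k" by auto
  then show ?thesis
    using assms q_factorial_nonzero[OF assms]
    by (auto simp: gauss_binomial_eq_0 gauss_binomial_q_factorial)
qed

text \<open>
  The value at \<open>1\<close> of the polynomial \<open>\<Prod>s<m. 1 - q\<^sup>s x\<close> of the \<open>q\<close>-binomial theorem. It is obtained here
  without that theorem, because the partial sums have the closed form in the proof.
\<close>
lemma gauss_binomial_alternating_sum:
  assumes "q > 1" "m > 0"
  shows "(\<Sum>s\<le>m. (- 1) ^ s * real q ^ (s choose 2) * gauss_binomial q m s) = 0"
proof -
  obtain k where m: "m = Suc k" using assms(2) gr0_implies_Suc by blast
  \<comment> \<open>Telescoping. At \<open>j = m\<close> the closed form contains \<open>gauss_binomial q k (Suc k) = 0\<close>.\<close>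
  have "(\<Sum>s\<le>j. (- 1) ^ s * real q ^ (s choose 2) * gauss_binomial q (Suc k) s)
      = (- 1) ^ j * real q ^ (Suc j choose 2) * gauss_binomial q k j" for j
  proof (induction j)
    case 0
    then show ?case by (simp add: numeral_2_eq_2)
  next
    case (Suc j)
    have c: "(Suc (Suc j) choose 2) = Suc j + (Suc j choose 2)"
      by (simp add: numeral_2_eq_2)
    show ?case
      by (simp only: sum.atMost_Suc Suc.IH gauss_binomial_Suc_Suc[OF assms(1)])
         (simp add: c power_add algebra_simps)
  qed
  from this[of m] show ?thesis by (simp add: m gauss_binomial_eq_0)
qed

text \<open>
  By the trinomial identity the factor \<open>gauss_binomial q i j\<close> comes out of the sum, and what remains is
  the alternating sum over row \<open>i - j\<close>, which vanishes unless \<open>i = j\<close>.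
\<close>
lemma gauss_binomial_orthogonality:
  assumes "q > 1" "i < m"
  shows "(\<Sum>t = j..<m. (- 1) ^ (t - j) * real q ^ ((t - j) choose 2)
            * gauss_binomial q t j * gauss_binomial q i t) = (if i = j then 1 else 0)"
proof (cases "j \<le> i")
  case True
  have "(\<Sum>t = j..<m. (- 1) ^ (t - j) * real q ^ ((t - j) choose 2)
            * gauss_binomial q t j * gauss_binomial q i t)
      = (\<Sum>t = j..i. (- 1) ^ (t - j) * real q ^ ((t - j) choose 2)
            * gauss_binomial q t j * gauss_binomial q i t)"
    using assms(2) by (intro sum.mono_neutral_right) (auto simp: gauss_binomial_eq_0)
  also have "\<dots> = (\<Sum>t = j..i. gauss_binomial q i j * ((- 1) ^ (t - j)
            * real q ^ ((t - j) choose 2) * gauss_binomial q (i - j) (t - j)))"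
    using gauss_binomial_trinomial[OF assms(1)]
    by (intro sum.cong refl) (simp add: mult_ac)
  also have "\<dots> = gauss_binomial q i j * (\<Sum>s\<le>i - j. (- 1) ^ s
            * real q ^ (s choose 2) * gauss_binomial q (i - j) s)"
    unfolding sum_distrib_left
    by (rule sum.reindex_bij_witness[of _ "\<lambda>s. s + j" "\<lambda>t. t - j"]) (use True in auto)
  also have "\<dots> = (if i = j then 1 else 0)"
  proof (cases "i = j")
    case True
    then show ?thesis
      using q_factorial_nonzero[OF assms(1)]
      by (simp add: gauss_binomial_q_factorial[OF assms(1)] numeral_2_eq_2)
  next
    case False
    with \<open>j \<le> i\<close> show ?thesis
      using gauss_binomial_alternating_sum[OF assms(1), of "i - j"] by simp
  qed
  finally show ?thesis .
next
  case False
  then show ?thesis by (auto intro!: sum.neutral simp: gauss_binomial_eq_0)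
qed

text \<open>
  The triangular matrix of Gaussian binomials is inverted by its signed version. This recovers a
  distribution \<open>B\<close> from its \<open>q\<close>-binomial moments.
\<close>
lemma gauss_binomial_inversion:
  assumes "q > 1" "j < m"
    and c: "\<And>t. t < m \<Longrightarrow> (\<Sum>i<m. B i * gauss_binomial q i t) = c t"
  shows "B j = (\<Sum>t = j..<m. (- 1) ^ (t - j) * real q ^ ((t - j) choose 2)
            * gauss_binomial q t j * c t)"
proof -
  have "(\<Sum>t = j..<m. (- 1) ^ (t - j) * real q ^ ((t - j) choose 2) * gauss_binomial q t j * c t)
      = (\<Sum>t = j..<m. \<Sum>i<m. B i * ((- 1) ^ (t - j) * real q ^ ((t - j) choose 2)
            * gauss_binomial q t j * gauss_binomial q i t))"
    using c by (intro sum.cong refl) (simp add: sum_distrib_left mult_ac flip: c)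
  also have "\<dots> = (\<Sum>i<m. B i * (\<Sum>t = j..<m. (- 1) ^ (t - j) * real q ^ ((t - j) choose 2)
            * gauss_binomial q t j * gauss_binomial q i t))"
    by (subst sum.swap) (simp add: sum_distrib_left)
  also have "\<dots> = (\<Sum>i<m. B i * (if i = j then 1 else 0))"
    using gauss_binomial_orthogonality[OF assms(1)] by (intro sum.cong refl) simp
  also have "\<dots> = B j"
    using assms(2) by (simp add: sum.delta if_distrib cong: if_cong)
  finally show ?thesis by simp
qed

text \<open>
  The left-hand side counts the linearly independent \<open>t\<close>-tuples in a space of dimension \<open>i\<close>; dividing by
  the number of ordered bases of a \<open>t\<close>-dimensional space leaves the number of \<open>t\<close>-dimensional
  subspaces. For \<open>i < t\<close> both sides vanish.
\<close>
lemma prod_diff_powers_gauss_binomial: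
  assumes "q > 1"
  shows "(\<Prod>j<t. real q ^ i - real q ^ j)
       = gauss_binomial q i t * (\<Prod>j<t. real q ^ t - real q ^ j)"
proof -
  have nz: "real q ^ Suc j - 1 \<noteq> 0" for j using q_power_neq_1[OF assms] by simp
  have *: "(\<Prod>j<t. real q ^ k - real q ^ j) = (\<Prod>j<t. real q ^ j) * (\<Prod>j<t. real q ^ (k - j) - 1)"
    if "t \<le> k" for k
    unfolding prod.distrib[symmetric] using that
    by (intro prod.cong refl) (simp add: algebra_simps flip: power_add)
  show ?thesis
  proof (cases "t \<le> i")
    case True
    have "(\<Prod>j<t. real q ^ (t - j) - 1) = (\<Prod>j<t. real q ^ (j + 1) - 1)"
      by (rule prod.reindex_bij_witness[of _ "\<lambda>j. t - Suc j" "\<lambda>j. t - Suc j"])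
         (auto simp: Suc_diff_Suc simp flip: power_Suc)
    with True show ?thesis
      using nz by (simp add: * gauss_binomial_def prod_dividef)
  next
    case False
    then show ?thesis by (auto simp: gauss_binomial_eq_0)
  qed
qed

section \<open>Counting in vector spaces over a finite field\<close>

locale finite_field_space = vector_space scale
  for scale :: "'a::{field,finite} \<Rightarrow> 'b::ab_group_add \<Rightarrow> 'b"
begin

lemma card_span_independent:
  assumes "finite B" "independent B"
  shows "finite (span B) \<and> card (span B) = CARD('a) ^ card B"
  using assms
proof (induction B)
  case empty
  then show ?case by simp
next
  case (insert b B)
  have b: "b \<notin> span B" and B: "independent B"
    using insert.prems insert.hyps(2) by (auto simp: independent_insert)
  let ?f = "\<lambda>(k, x). scale k b + x"
  have img: "span (insert b B) = ?f ` (UNIV \<times> span B)"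
  proof (intro equalityI subsetI)
    fix y assume "y \<in> span (insert b B)"
    then obtain k where "y - scale k b \<in> span B" by (auto simp: span_breakdown_eq)
    then show "y \<in> ?f ` (UNIV \<times> span B)"
      by (intro image_eqI[of _ _ "(k, y - scale k b)"]) auto
  next
    fix y assume "y \<in> ?f ` (UNIV \<times> span B)"
    then obtain k x where "x \<in> span B" "y = scale k b + x" by auto
    then show "y \<in> span (insert b B)"
      unfolding span_breakdown_eq by (intro exI[of _ k]) simp
  qed
  have inj: "inj_on ?f (UNIV \<times> span B)"
  proof (intro inj_onI, clarify)
    fix k x l y
    assume xy: "x \<in> span B" "y \<in> span B" and e: "scale k b + x = scale l b + y"
    have e': "scale (k - l) b = y - x" using e by (simp add: scale_left_diff_distrib algebra_simps)
    have "k = l"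
    proof (rule ccontr)
      assume "k \<noteq> l"
      then have "b = scale (inverse (k - l)) (y - x)" by (simp flip: e')
      then have "b \<in> span B" using xy by (metis span_diff span_scale)
      with b show False by simp
    qed
    then show "k = l \<and> x = y" using e by simp
  qed
  show ?case
    using insert B
    by (simp add: img card_image[OF inj] card_cartesian_product)
qed

lemma card_subspace:
  assumes "subspace S" "finite S"
  shows "card S = CARD('a) ^ dim S"
proof -
  obtain B where B: "B \<subseteq> S" "independent B" "S \<subseteq> span B" "card B = dim S"
    using basis_exists by blast
  have "span B = S" using B assms(1) by (simp add: span_subspace)
  then show ?thesis
    using card_span_independent[OF _ B(2)] B finite_subset[OF B(1) assms(2)] by simp
qed

text \<open>
  Independent tuples are counted in place of subspaces: their number is a plain product, found by adding
  one vector at a time, and \<open>prod_diff_powers_gauss_binomial\<close> turns it into a Gaussian binomial.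
\<close>
definition frames :: "'b set \<Rightarrow> nat \<Rightarrow> 'b list set" where
  "frames S t = {xs. length xs = t \<and> distinct xs \<and> independent (set xs) \<and> set xs \<subseteq> S}"

lemma finite_frames: "finite S \<Longrightarrow> finite (frames S t)"
  by (rule finite_subset[OF _ finite_lists_length_eq[of S t]]) (auto simp: frames_def)

lemma frames_Suc:
  "frames S (Suc t) = (\<lambda>(xs, x). x # xs) ` (SIGMA xs : frames S t. S - span (set xs))"
  (is "_ = ?R")
proof (intro equalityI subsetI)
  fix ys assume "ys \<in> frames S (Suc t)"
  then obtain x xs where "ys = x # xs" "length xs = t" "distinct (x # xs)"
      "independent (insert x (set xs))" "insert x (set xs) \<subseteq> S"
    unfolding frames_def by (auto simp: length_Suc_conv)
  then show "ys \<in> ?R"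
    by (intro image_eqI[of _ _ "(xs, x)"]) (auto simp: frames_def independent_insert)
next
  fix ys assume "ys \<in> ?R"
  then show "ys \<in> frames S (Suc t)"
    using independent_insertI by (auto simp: frames_def span_base)
qed

lemma card_frames:
  assumes "subspace S" "finite S"
  shows "real (card (frames S t)) = (\<Prod>j<t. real CARD('a) ^ dim S - real CARD('a) ^ j)"
proof (induction t)
  case 0
  have "frames S 0 = {[]}" using independent_empty by (auto simp: frames_def)
  then show ?case by simp
next
  case (Suc t)
  have inj: "inj_on (\<lambda>(xs, x). x # xs) A" for A :: "('b list \<times> 'b) set"
    by (auto simp: inj_on_def)
  have c: "real (card (S - span (set xs))) = real CARD('a) ^ dim S - real CARD('a) ^ t"
    if "xs \<in> frames S t" for xs
  proof -
    have xs: "independent (set xs)" "card (set xs) = t" and sub: "set xs \<subseteq> S"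
      using that by (auto simp: frames_def distinct_card)
    have sub: "span (set xs) \<subseteq> S" using sub assms(1) by (rule span_minimal)
    have "card (span (set xs)) = CARD('a) ^ t"
      using card_span_independent[OF _ xs(1)] xs(2) by simp
    moreover have "card (span (set xs)) \<le> card S" using assms(2) sub by (rule card_mono)
    ultimately show ?thesis
      using card_subspace[OF assms] finite_subset[OF sub assms(2)] sub
      by (simp add: card_Diff_subset of_nat_diff)
  qed
  have "card (frames S (Suc t)) = (\<Sum>xs\<in>frames S t. card (S - span (set xs)))"
    using assms(2) by (simp add: frames_Suc card_image[OF inj] card_SigmaI finite_frames)
  then have "real (card (frames S (Suc t))) = (\<Sum>xs\<in>frames S t. real CARD('a) ^ dim S - real CARD('a) ^ t)"
    using c by simp
  then show ?case by (simp add: Suc.IH)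
qed

end

section \<open>Annihilators\<close>

lemma scalar_product_add_left:
  "scalar_product (a + b) u = scalar_product a u + scalar_product b u"
  and scalar_product_add_right:
  "scalar_product a (u + v) = scalar_product a u + scalar_product a v"
  and scalar_product_scale_left:
  "scalar_product (c *s a) u = c * scalar_product a u"
  and scalar_product_scale_right:
  "scalar_product a (c *s u) = c * scalar_product a u"
  and scalar_product_zero [simp]: "scalar_product 0 u = 0" "scalar_product a 0 = 0"
  for a b u v :: "'f::comm_ring_1 ^ 'r"
  by (simp_all add: scalar_product_def sum.distrib algebra_simps sum_distrib_left)

lemma scalar_product_diff_left:
  "scalar_product (a - b) u = scalar_product a u - scalar_product b u"
  for a b u :: "'f::comm_ring_1 ^ 'r"
  by (simp add: scalar_product_def sum_subtractf algebra_simps)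

lemma subspace_kernel_scalar_product:
  "vec.subspace {u :: 'f::field ^ 'r. scalar_product a u = 0}"
  by (rule vec.subspaceI) (auto simp: scalar_product_add_right scalar_product_scale_right)

definition annihilator :: "('f::field ^ 'r) set \<Rightarrow> ('f ^ 'r) set" where
  "annihilator T = {a. \<forall>u\<in>T. scalar_product a u = 0}"

lemma annihilator_UNIV: "annihilator (UNIV :: ('f::field ^ 'r) set) = {0}"
proof -
  have "a = 0" if "\<forall>u. scalar_product a u = 0" for a :: "'f ^ 'r"
  proof -
    have "scalar_product a (axis i 1) = a $ i" for i
      by (simp add: scalar_product_def axis_def if_distrib cong: if_cong)
    with that show ?thesis by (simp add: vec_eq_iff)
  qed
  then show ?thesis by (auto simp: annihilator_def)
qed

text \<open>
  Every linear functional on \<open>'f ^ 'r\<close> is a scalar product, so a functional that vanishes on \<open>T\<close> but not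
  at \<open>x\<close> can be read off from any row of the matrix of an endomorphism with those values.
\<close>
lemma separating_functional:
  fixes x :: "'f::field ^ 'r"
  assumes "vec.independent (insert x T)" "x \<notin> T"
  obtains a where "a \<in> annihilator T" "scalar_product a x = 1"
proof -
  obtain g where g: "Vector_Spaces.linear (*s) (*s) g"
      "\<forall>y\<in>insert x T. g y = (if y = x then 1 else 0 :: 'f ^ 'r)"
    using vec.linear_independent_extend[OF assms(1), of "\<lambda>y. if y = x then 1 else 0"] by blast
  obtain i :: "'r" where "True" by simp
  have dot: "scalar_product (row i (matrix g)) y = g y $ i" for y
    using arg_cong[OF matrix_works[OF g(1), of y], of "\<lambda>v. v $ i"]
    by (simp add: scalar_product_def row_def matrix_vector_mult_def)
  show thesis
    using g(2) assms(2) by (intro that[of "row i (matrix g)"]) (auto simp: annihilator_def dot)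
qed

text \<open>
  Each further independent vector \<open>x\<close> divides the annihilator by \<open>CARD('f)\<close>: if \<open>a\<close> annihilates \<open>T\<close>
  and takes the value \<open>1\<close> at \<open>x\<close>, then the multiples of \<open>a\<close> represent the cosets of the smaller
  annihilator in the larger one.
\<close>
lemma card_annihilator:
  fixes T :: "('f::{field,finite} ^ 'r) set"
  assumes "vec.independent T"
  shows "card (annihilator T) * CARD('f) ^ card T = CARD('f) ^ CARD('r)"
  using finite[of T] assms
proof (induction T)
  case empty
  have "annihilator {} = (UNIV :: ('f ^ 'r) set)" by (auto simp: annihilator_def)
  then show ?case by simp
next
  case (insert x T)
  obtain a where a: "a \<in> annihilator T" "scalar_product a x = 1"
    using separating_functional[OF insert.prems insert.hyps(2)] .
  let ?f = "\<lambda>(c, b). c *s a + b"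
  have "annihilator T = ?f ` (UNIV \<times> annihilator (insert x T))"
  proof (intro equalityI subsetI)
    fix b assume "b \<in> annihilator T"
    then show "b \<in> ?f ` (UNIV \<times> annihilator (insert x T))"
      using a by (intro image_eqI[of _ _ "(scalar_product b x, b - scalar_product b x *s a)"])
        (auto simp: annihilator_def scalar_product_diff_left scalar_product_scale_left)
  next
    fix b assume "b \<in> ?f ` (UNIV \<times> annihilator (insert x T))"
    then show "b \<in> annihilator T"
      using a by (auto simp: annihilator_def scalar_product_add_left scalar_product_scale_left)
  qed
  moreover have "inj_on ?f (UNIV \<times> annihilator (insert x T))"
  proof (intro inj_onI, clarify)
    fix c b c' b' assume "b \<in> annihilator (insert x T)" "b' \<in> annihilator (insert x T)"
    then have b: "scalar_product b x = 0" "scalar_product b' x = 0"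
      by (simp_all add: annihilator_def)
    assume e: "c *s a + b = c' *s a + b'"
    have "c = c'"
      using arg_cong[OF e, of "\<lambda>v. scalar_product v x"] a(2) b
      by (simp add: scalar_product_add_left scalar_product_scale_left)
    with e show "c = c' \<and> b = b'" by simp
  qed
  ultimately have "card (annihilator T) = CARD('f) * card (annihilator (insert x T))"
    by (simp add: card_image card_cartesian_product)
  moreover have "vec.independent T" using insert.prems by (rule vec.independent_mono) auto
  ultimately show ?case using insert by (simp add: mult_ac)
qed

section \<open>Maximum scattered subspaces\<close>

text \<open>
  A maximum scattered space for \<open>h = r - 1\<close>; comparing ranks gives it dimension \<open>n\<close> over the small
  field. Below, the prefix \<open>sub\<close> refers to linear algebra over that field and \<open>vec\<close> to linear algebra
  over the large one.
\<close>
locale maximum_scattered =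
  fixes emb :: "'k::{field,finite} \<Rightarrow> 'f::{field,finite}" and U :: "('f ^ 'r) set" and q n r :: nat
  assumes embedding: "field_embedding emb"
    and card_k [simp]: "CARD('k) = q"
    and degree: "CARD('f) = q ^ n"
    and card_r [simp]: "CARD('r) = r"
    and at_least_line: "r \<ge> 2"
    and maximum: "maximum_h_scattered emb n (r - 1) U"
begin

sublocale sub: finite_field_space "restrict_scale emb :: 'k \<Rightarrow> 'f ^ 'r \<Rightarrow> 'f ^ 'r"
  unfolding finite_field_space_def by (rule vector_space_restrict_scale[OF embedding])

sublocale sub: finite_dimensional_vector_space
  "restrict_scale emb :: 'k \<Rightarrow> 'f ^ 'r \<Rightarrow> 'f ^ 'r"
  "vector_space.extend_basis (restrict_scale emb :: 'k \<Rightarrow> 'f ^ 'r \<Rightarrow> 'f ^ 'r) {}"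
  using sub.independent_extend_basis[OF sub.independent_empty]
    sub.span_extend_basis[OF sub.independent_empty]
  by unfold_locales auto

lemma q_gt_1: "q > 1"
proof -
  have "card {0, 1 :: 'k} \<le> CARD('k)" by (rule card_mono) auto
  then show ?thesis by simp
qed

lemma subspace_U: "sub.subspace U"
  and span_points: "vec.span (\<Union> (linear_set U)) = UNIV"
  and hyperplane_weight: "vec.subspace W \<Longrightarrow> vec.dim W = r - 1 \<Longrightarrow> sub.dim (W \<inter> U) \<le> r - 1"
  and dim_U: "sub.dim U = n"
  using maximum at_least_line
  by (auto simp: maximum_h_scattered_def h_scattered_def weight_def)

lemma sub_subspace_of_subspace: "vec.subspace W \<Longrightarrow> sub.subspace W"
  by (simp add: sub.subspace_def vec.subspace_def restrict_scale_def)

lemma sub_span_le: "sub.span S \<subseteq> vec.span S"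
  by (intro sub.span_minimal sub_subspace_of_subspace vec.subspace_span) (auto intro: vec.span_base)

lemma span_U: "vec.span U = UNIV"
proof -
  have "\<Union> (linear_set U) \<subseteq> vec.span U"
    unfolding linear_set_def by (auto intro: vec.span_mono[THEN subsetD, rotated])
  then have "vec.span (\<Union> (linear_set U)) \<subseteq> vec.span U"
    by (rule vec.span_minimal) (rule vec.subspace_span)
  then show ?thesis using span_points by auto
qed

lemma r_le_n: "r \<le> n"
proof -
  obtain B where B: "B \<subseteq> U" "sub.independent B" "U \<subseteq> sub.span B" "card B = sub.dim U"
    using sub.basis_exists by blast
  have "vec.span U \<subseteq> vec.span B"
    using B(3) sub_span_le by (intro vec.span_minimal) auto
  then have "vec.dim (UNIV :: ('f ^ 'r) set) \<le> card B"
    using span_U by (intro vec.dim_le_card) auto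
  then show ?thesis using B(4) dim_U by (simp add: vec_dim_card del: vec.dim_UNIV)
qed

text \<open>
  The scattering hypothesis speaks of hyperplanes only. It passes to smaller subspaces \<open>W\<close>: since \<open>U\<close>
  spans the whole space, \<open>W\<close> can be enlarged to a hyperplane by adjoining vectors of \<open>U\<close>, and every
  such vector raises the weight by at least one.
\<close>
lemma subspace_weight_le:
  assumes "vec.subspace W" "vec.dim W < r"
  shows "sub.dim (W \<inter> U) \<le> vec.dim W"
proof -
  \<comment> \<open>Induction on the codimension \<open>m\<close> of \<open>W\<close> in a hyperplane.\<close>
  have "sub.dim (W \<inter> U) + m \<le> r - 1"
    if "vec.subspace W" "vec.dim W + m = r - 1" for m and W :: "('f ^ 'r) set"
    using that
  proof (induction m arbitrary: W)
    case 0
    then show ?case using hyperplane_weight by simp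
  next
    case (Suc m)
    have "W \<noteq> UNIV" using Suc.prems by (auto simp: vec_dim_card simp del: vec.dim_UNIV)
    then have "\<not> U \<subseteq> W"
      using vec.span_minimal[OF _ Suc.prems(1), of U] span_U by auto
    then obtain u where u: "u \<in> U" "u \<notin> W" by auto
    let ?W = "vec.span (insert u W)"
    have "vec.dim ?W + m = r - 1"
      using Suc.prems u by (simp add: vec.dim_insert vec.span_eq_iff[THEN iffD2])
    then have "sub.dim (?W \<inter> U) + m \<le> r - 1"
      by (intro Suc.IH vec.subspace_span)
    moreover have "u \<notin> sub.span (W \<inter> U)"
      using u sub.span_minimal[OF _ sub_subspace_of_subspace[OF Suc.prems(1)], of "W \<inter> U"] by auto
    then have "Suc (sub.dim (W \<inter> U)) = sub.dim (insert u (W \<inter> U))"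
      by (simp add: sub.dim_insert)
    moreover have "insert u (W \<inter> U) \<subseteq> ?W \<inter> U"
      using u by (auto intro: vec.span_base)
    then have "sub.dim (insert u (W \<inter> U)) \<le> sub.dim (?W \<inter> U)"
      by (rule sub.dim_subset)
    ultimately show ?case by linarith
  qed
  from this[of W "r - 1 - vec.dim W"] assms show ?thesis by simp
qed

text \<open>
  The form in which the scattering hypothesis is used: if few vectors of \<open>U\<close> became dependent over the
  large field, their span would have weight larger than its dimension.
\<close>
lemma independent_lift:
  assumes "sub.independent T" "T \<subseteq> U" "card T \<le> r"
  shows "vec.independent T"
proof (rule ccontr)
  assume dep: "\<not> vec.independent T"
  have "vec.dim T < card T"
  proof -
    obtain B where B: "B \<subseteq> T" "vec.independent B" "T \<subseteq> vec.span B" "card B = vec.dim T"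
      using vec.basis_exists by blast
    then have "B \<noteq> T" using dep by auto
    then show ?thesis using B(1,4) psubset_card_mono[of T B] by auto
  qed
  moreover from this have "sub.dim (vec.span T \<inter> U) \<le> vec.dim (vec.span T)"
    using assms(3) by (intro subspace_weight_le vec.subspace_span) simp
  moreover have "card T \<le> sub.dim (vec.span T \<inter> U)"
    using assms(1,2) by (intro sub.independent_card_le_dim) (auto intro: vec.span_base)
  ultimately show False by simp
qed

text \<open>
  The number of functionals vanishing on a subspace of \<open>U\<close> of dimension at most \<open>r\<close> thus depends only
  on that dimension, as for a maximum rank distance code. All the counting rests on this.
\<close>
lemma card_annihilator_independent:
  assumes "sub.independent T" "T \<subseteq> U" "card T \<le> r"
  shows "card (annihilator T) = q ^ (n * (r - card T))"
proof -
  obtain j where j: "r = card T + j" using assms(3) le_Suc_ex by blast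
  have "card (annihilator T) * CARD('f) ^ card T = CARD('f) ^ j * CARD('f) ^ card T"
    using card_annihilator[OF independent_lift[OF assms]] by (simp add: j power_add)
  then show ?thesis using j q_gt_1 by (simp add: degree power_mult)
qed

text \<open>
  The kernel of the map \<open>u \<mapsto> scalar_product a u\<close> on \<open>U\<close>. For nonzero \<open>a\<close> it is the part of \<open>U\<close> in
  the hyperplane with coordinates \<open>a\<close>.
\<close>
definition "ker a = {u \<in> U. scalar_product a u = 0}"

lemma subspace_ker: "sub.subspace (ker a)"
proof -
  have "ker a = U \<inter> {u. scalar_product a u = 0}" by (auto simp: ker_def)
  then show ?thesis
    using sub.subspace_inter[OF subspace_U
        sub_subspace_of_subspace[OF subspace_kernel_scalar_product]] by simp
qed

lemma dim_ker_less:
  assumes "a \<noteq> 0"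
  shows "sub.dim (ker a) < r"
proof -
  let ?H = "{u. scalar_product a u = 0}"
  have "?H \<noteq> UNIV" using assms annihilator_UNIV by (auto simp: annihilator_def)
  then have "vec.dim ?H < vec.dim (UNIV :: ('f ^ 'r) set)"
    using subspace_kernel_scalar_product[of a] by (intro vec.dim_psubset) (auto simp: vec.span_eq_iff[THEN iffD2])
  then have "vec.dim ?H < r" by (simp add: vec_dim_card del: vec.dim_UNIV)
  moreover have "ker a = ?H \<inter> U" by (auto simp: ker_def)
  ultimately show ?thesis
    using subspace_weight_le[OF subspace_kernel_scalar_product[of a]] by simp
qed

section \<open>Distribution of the kernel dimensions\<close>

definition "kernel_count i = card {a. a \<noteq> 0 \<and> sub.dim (ker a) = i}"

text \<open>
  Both sides count the pairs of a nonzero \<open>a\<close> and an independent \<open>t\<close>-tuple of vectors in \<open>ker a\<close>.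
\<close>
lemma frames_double_count:
  assumes "t \<le> r"
  shows "(\<Sum>a\<in>- {0}. card (sub.frames (ker a) t)) = card (sub.frames U t) * (q ^ (n * (r - t)) - 1)"
proof -
  have "(\<Sum>a\<in>- {0}. card (sub.frames (ker a) t))
      = (\<Sum>a\<in>- {0}. \<Sum>xs\<in>sub.frames U t. if a \<in> annihilator (set xs) then 1 else 0)"
  proof (intro sum.cong refl)
    fix a
    have "sub.frames (ker a) t = {xs \<in> sub.frames U t. a \<in> annihilator (set xs)}"
      by (auto simp: sub.frames_def ker_def annihilator_def)
    then show "card (sub.frames (ker a) t)
        = (\<Sum>xs\<in>sub.frames U t. if a \<in> annihilator (set xs) then 1 else 0)"
      by (simp add: sub.finite_frames sum.If_cases Int_def)
  qed
  also have "\<dots> = (\<Sum>xs\<in>sub.frames U t. \<Sum>a\<in>- {0}. if a \<in> annihilator (set xs) then 1 else 0)"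
    by (rule sum.swap)
  also have "\<dots> = (\<Sum>xs\<in>sub.frames U t. q ^ (n * (r - t)) - 1)"
  proof (intro sum.cong refl)
    fix xs assume xs: "xs \<in> sub.frames U t"
    then have "card (annihilator (set xs)) = q ^ (n * (r - t))"
      using card_annihilator_independent[of "set xs"] assms by (auto simp: sub.frames_def distinct_card)
    moreover have "(0 :: 'f ^ 'r) \<in> annihilator (set xs)" by (simp add: annihilator_def)
    moreover have "{a \<in> - {0}. a \<in> annihilator (set xs)} = annihilator (set xs) - {0}" by auto
    ultimately show "(\<Sum>a\<in>- {0}. if a \<in> annihilator (set xs) then 1 else 0) = q ^ (n * (r - t)) - 1"
      by (simp add: sum.If_cases Int_def)
  qed
  finally show ?thesis by simp
qed

text \<open>
  The double count, sorted by \<open>sub.dim (ker a)\<close> and divided by the number of ordered bases of a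
  \<open>t\<close>-dimensional space.
\<close>
lemma kernel_count_moments:
  assumes "t < r"
  shows "(\<Sum>i<r. real (kernel_count i) * gauss_binomial q i t)
       = gauss_binomial q n t * (real q ^ (n * (r - t)) - 1)"
proof -
  let ?P = "\<lambda>i. \<Prod>j<t. real q ^ i - real q ^ j"
  have nz: "?P t \<noteq> 0" using q_gt_1 by simp
  have "(\<Sum>i<r. real (kernel_count i) * ?P i)
      = (\<Sum>i<r. \<Sum>a | a \<in> - {0} \<and> sub.dim (ker a) = i. ?P (sub.dim (ker a)))"
    by (intro sum.cong refl) (simp add: kernel_count_def)
  also have "\<dots> = (\<Sum>a\<in>- {0}. ?P (sub.dim (ker a)))"
    using dim_ker_less by (intro sum.group) auto
  also have "\<dots> = real (\<Sum>a\<in>- {0}. card (sub.frames (ker a) t))"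
    by (simp add: sub.card_frames[OF subspace_ker])
  also have "\<dots> = ?P n * (real q ^ (n * (r - t)) - 1)"
    using q_gt_1 assms
    by (simp add: frames_double_count sub.card_frames[OF subspace_U] dim_U of_nat_diff)
  finally have moment: "(\<Sum>i<r. real (kernel_count i) * ?P i)
      = ?P n * (real q ^ (n * (r - t)) - 1)" .
  have P: "?P i = gauss_binomial q i t * ?P t" for i
    by (rule prod_diff_powers_gauss_binomial[OF q_gt_1])
  have "(\<Sum>i<r. real (kernel_count i) * gauss_binomial q i t) * ?P t
      = (\<Sum>i<r. real (kernel_count i) * ?P i)"
    unfolding sum_distrib_right
  proof (intro sum.cong refl)
    fix i
    show "real (kernel_count i) * gauss_binomial q i t * ?P t = real (kernel_count i) * ?P i"
      using P[of i] by (simp add: mult.assoc)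
  qed
  also have "\<dots> = (gauss_binomial q n t * (real q ^ (n * (r - t)) - 1)) * ?P t"
    using moment P[of n] by (simp only: mult_ac)
  finally have "(\<Sum>i<r. real (kernel_count i) * gauss_binomial q i t) * ?P t
      = (gauss_binomial q n t * (real q ^ (n * (r - t)) - 1)) * ?P t" .
  with nz show ?thesis by simp
qed

text \<open>
  Inversion of the moments. The trinomial identity pulls \<open>gauss_binomial q n i\<close> out of the sum, where
  \<open>i = r - 1 - l\<close> is the dimension of the kernel and \<open>n - i\<close> the rank of the map defined by \<open>a\<close>;
  reversing the order of summation then gives the usual form of the rank distribution.
\<close>
lemma kernel_count_formula:
  assumes "l < r"
  shows "real (kernel_count (r - 1 - l)) = gauss_binomial q n (n - (r - 1 - l)) *
      (\<Sum>t = 0..l. (- 1) powi (int t - int l) * gauss_binomial q (n - (r - 1 - l)) (l - t)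
          * real q ^ ((l - t) choose 2) * (real q ^ (n * (t + 1)) - 1))"
proof -
  define i where "i = r - 1 - l"
  have i: "i < r" "l = r - 1 - i" using assms by (auto simp: i_def)
  have "real (kernel_count i) = (\<Sum>t = i..<r. (- 1) ^ (t - i) * real q ^ ((t - i) choose 2)
          * gauss_binomial q t i * (gauss_binomial q n t * (real q ^ (n * (r - t)) - 1)))"
    using kernel_count_moments
    by (intro gauss_binomial_inversion[OF q_gt_1 i(1), where B = "\<lambda>i. real (kernel_count i)"])
  also have "\<dots> = (\<Sum>t = i..<r. gauss_binomial q n (n - i) * ((- 1) ^ (t - i)
        * gauss_binomial q (n - i) (t - i) * real q ^ ((t - i) choose 2)
        * (real q ^ (n * (r - t)) - 1)))"
  proof (intro sum.cong refl)
    fix t assume t: "t \<in> {i..<r}"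
    then have "gauss_binomial q n t * gauss_binomial q t i
        = gauss_binomial q n (n - i) * gauss_binomial q (n - i) (t - i)"
      using gauss_binomial_trinomial[OF q_gt_1, of i t n]
        gauss_binomial_symmetric[OF q_gt_1, of i n] r_le_n by simp
    then show "(- 1) ^ (t - i) * real q ^ ((t - i) choose 2) * gauss_binomial q t i
          * (gauss_binomial q n t * (real q ^ (n * (r - t)) - 1))
        = gauss_binomial q n (n - i) * ((- 1) ^ (t - i) * gauss_binomial q (n - i) (t - i)
          * real q ^ ((t - i) choose 2) * (real q ^ (n * (r - t)) - 1))"
      by (simp add: mult_ac)
  qed
  also have "\<dots> = gauss_binomial q n (n - i) * (\<Sum>t = i..<r. (- 1) ^ (t - i)
        * gauss_binomial q (n - i) (t - i) * real q ^ ((t - i) choose 2)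
        * (real q ^ (n * (r - t)) - 1))"
    by (simp add: sum_distrib_left)
  also have "(\<Sum>t = i..<r. (- 1) ^ (t - i)
        * gauss_binomial q (n - i) (t - i) * real q ^ ((t - i) choose 2)
        * (real q ^ (n * (r - t)) - 1))
      = (\<Sum>t = 0..l. (- 1) powi (int t - int l) * gauss_binomial q (n - i) (l - t)
          * real q ^ ((l - t) choose 2) * (real q ^ (n * (t + 1)) - 1))"
  proof (rule sum.reindex_bij_witness[of _ "\<lambda>t. r - 1 - t" "\<lambda>t. r - 1 - t"])
    fix t assume t: "t \<in> {i..<r}"
    then have e: "l - (r - 1 - t) = t - i" "r - 1 - t + 1 = r - t" "r - 1 - t \<le> l" using i by auto
    have "(- 1 :: real) powi (int s - int l) = (- 1) ^ (l - s)" if "s \<le> l" for s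
      using that by (auto simp: power_int_def nat_diff_distrib)
    from this[OF e(3)]
    show "(- 1) powi (int (r - 1 - t) - int l) * gauss_binomial q (n - i) (l - (r - 1 - t))
          * real q ^ ((l - (r - 1 - t)) choose 2) * (real q ^ (n * (r - 1 - t + 1)) - 1)
        = (- 1) ^ (t - i) * gauss_binomial q (n - i) (t - i) * real q ^ ((t - i) choose 2)
          * (real q ^ (n * (r - t)) - 1)"
      by (simp only: e)
  qed (use i in auto)
  finally show ?thesis by (simp add: i_def)
qed

text \<open>
  A union bound. Fix an \<open>i\<close>-dimensional subspace \<open>S\<close> of \<open>U\<close>. Of the \<open>q ^ (n * (r - i))\<close> functionals that
  vanish on \<open>S\<close>, at most \<open>q ^ (n * (r - i - 1))\<close> vanish at any given one of the \<open>q ^ n - q ^ i\<close> remaining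
  vectors of \<open>U\<close>. These are too few to exhaust the annihilator, so some functional has kernel exactly \<open>S\<close>.
\<close>
lemma kernel_dim_attained:
  assumes "i < r"
  shows "\<exists>a. a \<noteq> 0 \<and> sub.dim (ker a) = i"
proof -
  obtain B where B: "B \<subseteq> U" "sub.independent B" "U \<subseteq> sub.span B" "card B = n"
    using sub.basis_exists[of U] dim_U by auto
  obtain T where "T \<subseteq> B" and cT: "card T = i"
    using obtain_subset_with_card_n[of i B] B(4) assms r_le_n by auto
  then have T: "sub.independent T" "T \<subseteq> U" using B sub.independent_mono by auto
  let ?S = "sub.span T"
  have cS: "card ?S = q ^ i" using sub.card_span_independent[OF _ T(1)] cT by simp
  have S: "?S \<subseteq> U" using T(2) subspace_U by (rule sub.span_minimal)
  have cU: "card U = q ^ n" using sub.card_subspace[OF subspace_U] dim_U by simp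
  have annT: "card (annihilator T) = q ^ (n * (r - i))"
    using card_annihilator_independent[OF T] cT assms by simp
  have bad: "card (annihilator (insert u T)) = q ^ (n * (r - Suc i))" if "u \<in> U - ?S" for u
  proof -
    have "u \<notin> T" using that sub.span_base by auto
    then show ?thesis
      using that T cT assms card_annihilator_independent[of "insert u T"]
        sub.independent_insertI[of u T] by simp
  qed
  have "card (\<Union>u\<in>U - ?S. annihilator (insert u T)) \<le> (\<Sum>u\<in>U - ?S. card (annihilator (insert u T)))"
    by (rule card_UN_le) simp
  also have "\<dots> = (q ^ n - q ^ i) * q ^ (n * (r - Suc i))"
    using S by (simp add: bad card_Diff_subset cS cU)
  also have "\<dots> < q ^ n * q ^ (n * (r - Suc i))"
    using q_gt_1 by (intro mult_strict_right_mono diff_less) auto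
  also have "\<dots> = q ^ (n * Suc (r - Suc i))" by (simp add: power_add)
  also have "Suc (r - Suc i) = r - i" using assms by simp
  finally have "\<not> annihilator T \<subseteq> (\<Union>u\<in>U - ?S. annihilator (insert u T))"
    using card_mono[of "\<Union>u\<in>U - ?S. annihilator (insert u T)" "annihilator T"] annT by auto
  then obtain a where a: "a \<in> annihilator T" "\<And>u. u \<in> U - ?S \<Longrightarrow> a \<notin> annihilator (insert u T)"
    by auto
  have "T \<subseteq> ker a" using a(1) T(2) by (auto simp: ker_def annihilator_def)
  then have "?S \<subseteq> ker a" using subspace_ker by (rule sub.span_minimal)
  moreover have "ker a \<subseteq> ?S" using a by (auto simp: ker_def annihilator_def)
  ultimately have k: "ker a = ?S" by auto
  then have "sub.dim (ker a) = i" using T(1) cT by (simp add: sub.dim_eq_card_independent)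
  moreover have "a \<noteq> 0"
  proof
    assume "a = 0"
    then have "ker a = U" by (auto simp: ker_def)
    with \<open>sub.dim (ker a) = i\<close> show False using dim_U assms r_le_n by simp
  qed
  ultimately show ?thesis by blast
qed

section \<open>Points of the linear set in a hyperplane\<close>

text \<open>
  Every point of the linear set comes from exactly \<open>q - 1\<close> vectors of \<open>U\<close>: two vectors of \<open>U\<close> that are
  proportional over the large field are already proportional over the small one, by
  \<open>independent_lift\<close> for two vectors, which needs \<open>r \<ge> 2\<close>.
\<close>
lemma card_linear_set:
  assumes "sub.subspace S" "S \<subseteq> U"
  shows "card (linear_set S) * (q - 1) = q ^ sub.dim S - 1"
proof -
  have fibre: "{v \<in> S - {0}. vec.span {v} = vec.span {u}} = sub.span {u} - {0}"
    if u: "u \<in> S - {0}" for u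
  proof (intro equalityI subsetI)
    fix v assume v: "v \<in> {v \<in> S - {0}. vec.span {v} = vec.span {u}}"
    show "v \<in> sub.span {u} - {0}"
    proof (rule ccontr)
      assume "v \<notin> sub.span {u} - {0}"
      with v have nv: "v \<notin> sub.span {u}" by simp
      then have "v \<noteq> u" using sub.span_base by auto
      have "sub.independent {u}" using u by simp
      then have "sub.independent {v, u}" using nv by (simp only: sub.independent_insertI not_False_eq_True)
      moreover have "card {v, u} \<le> r" using \<open>v \<noteq> u\<close> at_least_line by simp
      ultimately have "vec.independent {v, u}"
        using u v assms(2) by (intro independent_lift) auto
      then have "v \<notin> vec.span {u}" using \<open>v \<noteq> u\<close> by (simp add: vec.independent_insert)
      moreover have "v \<in> vec.span {v}" by (simp add: vec.span_base)
      ultimately show False using v by simp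
    qed
  next
    fix v assume v: "v \<in> sub.span {u} - {0}"
    then obtain c where c: "v = emb c *s u"
      by (auto simp: sub.span_singleton restrict_scale_def)
    then have "emb c \<noteq> 0" using v by auto
    then have u_v: "u = inverse (emb c) *s v" by (simp add: c)
    have "v \<in> vec.span {u}" unfolding c by (intro vec.span_scale vec.span_base) simp
    moreover have "u \<in> vec.span {v}" by (subst u_v) (intro vec.span_scale vec.span_base, simp)
    ultimately have "vec.span {v} = vec.span {u}" by (simp add: vec.span_eq)
    moreover have "v \<in> S"
      using v u sub.span_minimal[OF _ assms(1), of "{u}"] by auto
    ultimately show "v \<in> {v \<in> S - {0}. vec.span {v} = vec.span {u}}" using v by simp
  qed
  have "card (S - {0}) = (\<Sum>P\<in>linear_set S. card {v \<in> S - {0}. vec.span {v} = P})"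
    unfolding linear_set_def using sum.image_gen[of "S - {0}" "\<lambda>_. 1 :: nat" "\<lambda>u. vec.span {u}"] by simp
  also have "\<dots> = (\<Sum>P\<in>linear_set S. q - 1)"
  proof (intro sum.cong refl)
    fix P assume "P \<in> linear_set S"
    then obtain u where u: "u \<in> S - {0}" "P = vec.span {u}" by (auto simp: linear_set_def)
    have "card (sub.span {u}) = q ^ card {u}"
      using sub.card_span_independent[of "{u}"] u by simp
    then have "card (sub.span {u} - {0}) = q - 1"
      by (simp add: card_Diff_singleton sub.span_zero)
    then show "card {v \<in> S - {0}. vec.span {v} = P} = q - 1" by (simp only: u(2) fibre[OF u(1)])
  qed
  finally show ?thesis
    using sub.card_subspace[OF assms(1)] sub.subspace_0[OF assms(1)] by (simp add: card_Diff_singleton)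
qed

lemma card_linear_set_theta:
  assumes "sub.subspace S" "S \<subseteq> U"
  shows "card (linear_set S) = theta q (int (sub.dim S) - 1)"
proof -
  have "card (linear_set S) = (q ^ sub.dim S - 1) div (q - 1)"
    using card_linear_set[OF assms, symmetric] q_gt_1 by simp
  then show ?thesis by (cases "sub.dim S") (simp_all add: theta_def)
qed

end

section \<open>Weights of the code\<close>

lemma vector_matrix_mult_nth: "(a v* G) $ j = scalar_product a (column j G)"
  for a :: "'f::comm_ring_1 ^ 'r"
  by (simp add: vector_matrix_mult_def scalar_product_def column_def)

lemma generated_code_eq_range: "generated_code G = range (\<lambda>a. a v* G)"
  for G :: "'f::field ^ 'm ^ 'r"
proof
  have comb: "a v* G = (\<Sum>i\<in>UNIV. a $ i *s row i G)" for a
    by (simp add: vec_eq_iff vector_matrix_mult_def row_def)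
  show "range (\<lambda>a. a v* G) \<subseteq> generated_code G"
  proof clarify
    fix a
    have "row i G \<in> vec.span (rows G)" for i
      by (rule vec.span_base) (auto simp: rows_def)
    then show "a v* G \<in> generated_code G"
      unfolding generated_code_def comb by (intro vec.span_sum vec.span_scale)
  qed
  have "vec.subspace (range (\<lambda>a. a v* G))"
  proof (rule vec.subspaceI)
    show "0 \<in> range (\<lambda>a. a v* G)" by (rule range_eqI[of _ _ 0]) simp
  next
    fix x y assume "x \<in> range (\<lambda>a. a v* G)" "y \<in> range (\<lambda>a. a v* G)"
    then obtain a b where "x = a v* G" "y = b v* G" by auto
    then show "x + y \<in> range (\<lambda>a. a v* G)"
      by (intro range_eqI[of _ _ "a + b"]) (simp add: vector_matrix_left_distrib)
  next
    fix c x assume "x \<in> range (\<lambda>a. a v* G)"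
    then obtain a where "x = a v* G" by auto
    then show "c *s x \<in> range (\<lambda>a. a v* G)"
      by (intro range_eqI[of _ _ "c *s a"])
        (simp add: vec_eq_iff vector_matrix_mult_nth scalar_product_scale_left)
  qed
  moreover have "row i G \<in> range (\<lambda>a. a v* G)" for i
  proof -
    have "axis i 1 v* G = row i G"
      by (simp add: vec_eq_iff vector_matrix_mult_def row_def axis_def if_distrib[of "\<lambda>x. x * _"]
          cong: if_cong)
    then show ?thesis by (metis rangeI)
  qed
  ultimately show "generated_code G \<subseteq> range (\<lambda>a. a v* G)"
    unfolding generated_code_def by (intro vec.span_minimal) (auto simp: rows_def)
qed

lemma theta_times:
  assumes "q > 1"
  shows "theta q (int i - 1) * (q - 1) = q ^ i - 1"
proof -
  obtain p where q: "q = Suc p" using assms by (cases q) auto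
  have "p * (\<Sum>k<i. q ^ k) + 1 = q ^ i" by (induction i) (auto simp: q algebra_simps)
  then have "q - 1 dvd q ^ i - 1" by (metis add_diff_cancel_right' diff_Suc_1 dvd_triv_left q)
  then show ?thesis by (cases i) (simp_all add: theta_def)
qed

lemma theta_less:
  assumes "q > 1" "i < j"
  shows "theta q (int i - 1) < theta q (int j - 1)"
proof -
  have "q ^ i - 1 < q ^ j - 1"
    using assms power_strict_increasing[OF assms(2,1)] one_le_power[of q i] by linarith
  then have "theta q (int i - 1) * (q - 1) < theta q (int j - 1) * (q - 1)"
    by (simp only: theta_times[OF assms(1)])
  then show ?thesis by simp
qed

context maximum_scattered
begin

lemma card_linear_set_U: "card (linear_set U) = theta q (int n - 1)"
  using card_linear_set_theta[OF subspace_U] dim_U by simp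

text \<open>
  The zero entries of the codeword of \<open>a\<close> correspond to the points of the linear set on which \<open>a\<close>
  vanishes, whichever vectors represent them, and these are the points of the linear set of \<open>ker a\<close>.
\<close>
lemma hamming_weight_codeword:
  fixes G :: "'f ^ 'm ^ 'r"
  assumes "represents_points G (linear_set U)"
  shows "hamming_weight (a v* G) = card (linear_set U) - theta q (int (sub.dim (ker a)) - 1)"
proof -
  let ?P = "\<lambda>j. vec.span {column j G}"
  let ?Z = "{j. scalar_product a (column j G) = 0}"
  have bij: "bij_betw ?P UNIV (linear_set U)"
    using assms by (simp add: represents_points_def)
  have in_kernel: "scalar_product a v = 0"
    if "scalar_product a u = 0" "vec.span {v} = vec.span {u}" for u v
  proof -
    have "vec.span {u} \<subseteq> {u. scalar_product a u = 0}"
      using that(1) by (intro vec.span_minimal subspace_kernel_scalar_product) simp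
    moreover have "v \<in> vec.span {v}" by (simp add: vec.span_base)
    ultimately show ?thesis using that(2) by auto
  qed
  have "?P ` ?Z = linear_set (ker a)"
  proof (intro equalityI subsetI)
    fix P assume "P \<in> ?P ` ?Z"
    then obtain j where j: "scalar_product a (column j G) = 0" "P = ?P j" by auto
    moreover have "?P j \<in> linear_set U" using bij by (auto simp: bij_betw_def)
    then obtain u where "u \<in> U - {0}" "?P j = vec.span {u}" by (auto simp: linear_set_def)
    ultimately show "P \<in> linear_set (ker a)"
      using in_kernel[of "column j G" u] by (auto simp: linear_set_def ker_def)
  next
    fix P assume "P \<in> linear_set (ker a)"
    then obtain u where u: "u \<in> U - {0}" "scalar_product a u = 0" "P = vec.span {u}"
      by (auto simp: linear_set_def ker_def)
    then have "P \<in> range ?P" using bij by (auto simp: bij_betw_def linear_set_def)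
    then obtain j where "P = ?P j" by auto
    then show "P \<in> ?P ` ?Z" using u in_kernel[of u "column j G"] by auto
  qed
  then have "bij_betw ?P ?Z (linear_set (ker a))"
    using bij by (auto simp: bij_betw_def intro: inj_on_subset)
  then have "card ?Z = theta q (int (sub.dim (ker a)) - 1)"
    using card_linear_set_theta[OF subspace_ker, of a] by (simp add: bij_betw_same_card ker_def)
  moreover have "CARD('m) = card (linear_set U)" using bij by (rule bij_betw_same_card)
  moreover have "{j. (a v* G) $ j \<noteq> 0} = UNIV - ?Z" by (auto simp: vector_matrix_mult_nth)
  ultimately show ?thesis by (simp add: hamming_weight_def card_Diff_subset)
qed

text \<open>
  A nonzero \<open>a\<close> has a codeword of positive weight because \<open>ker a\<close>, of dimension less than \<open>r \<le> n\<close>,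
  misses some point.
\<close>
lemma inj_encoding:
  fixes G :: "'f ^ 'm ^ 'r"
  assumes "represents_points G (linear_set U)"
  shows "inj (\<lambda>a. a v* G)"
proof (rule injI)
  fix a b assume e: "a v* G = b v* G"
  have "(a - b) v* G = 0" using e by (simp add: vector_matrix_mult_diff_distrib)
  then have "hamming_weight ((a - b) v* G) = 0" by (simp add: hamming_weight_def)
  moreover have "hamming_weight ((a - b) v* G) > 0" if "a - b \<noteq> 0"
    using theta_less[OF q_gt_1, of "sub.dim (ker (a - b))" n] dim_ker_less[OF that] r_le_n
    by (simp add: hamming_weight_codeword[OF assms] card_linear_set_U)
  ultimately show "a = b" by fastforce
qed

end

section \<open>The weight enumerator\<close>

theorem corollary5p7:
  fixes emb :: "'k::{field,finite} \<Rightarrow> 'f::{field,finite}"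
    and U :: "('f ^ 'r) set"
    and G :: "'f ^ 'm ^ 'r"
    and q n r N d :: nat
    and w :: "nat \<Rightarrow> nat"
    and A :: "nat \<Rightarrow> real"
  assumes "field_embedding emb"
    and "CARD('k) = q" and "CARD('f) = q ^ n" and "n \<ge> 1"
    and "CARD('r) = r" and "r \<ge> 2"
    and "maximum_h_scattered emb n (r - 1) U"
    and "represents_points G (linear_set U)"
    and "N = card (linear_set U)"
    and "\<And>i. w i = N - theta q (int i - 1)"
    and "d = n - r + 1"
    and "\<And>l. l \<in> {0..n - d} \<Longrightarrow>
           A (d + l) = gauss_binomial q n (d + l) *
             (\<Sum>t = 0..l. (- 1) powi (int t - int l) * gauss_binomial q (l + d) (l - t)
                * real q ^ ((l - t) choose 2) * (real q ^ (n * (t + 1)) - 1))"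
  shows "real N = (real q ^ n - 1) / (real q - 1) \<and>
         weight_code r (generated_code G) \<and>
         nonzero_weights (generated_code G) = w ` {0..r - 1} \<and>
         weight_enumerator (generated_code G) = 1 + (\<Sum>i = 0..r - 1. monom (A (n - i)) (w i))"
proof -
  interpret maximum_scattered emb U q n r
    using assms by unfold_locales auto
  let ?C = "generated_code G"
  let ?\<kappa> = "\<lambda>a. sub.dim (ker a)"
  have r_range: "{0..r - 1} = {..<r}" using assms(6) by auto
  have hw: "hamming_weight (a v* G) = w (?\<kappa> a)" for a
    using hamming_weight_codeword[OF assms(8)] assms(9,10) by simp
  have C: "?C = range (\<lambda>a. a v* G)" by (rule generated_code_eq_range)
  have inj: "inj (\<lambda>a. a v* G)" by (rule inj_encoding[OF assms(8)])
  have zero: "a v* G = 0 \<longleftrightarrow> a = 0" for a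
    using inj_eq[OF inj, of a 0] by simp

  have "real N * (real q - 1) = real q ^ n - 1"
    using arg_cong[OF theta_times[OF q_gt_1, of n], of real] q_gt_1
    by (simp add: assms(9) card_linear_set_U of_nat_diff)
  then have number: "real N = (real q ^ n - 1) / (real q - 1)"
    using q_gt_1 by (simp add: field_simps)

  have "?\<kappa> ` (- {0}) = {..<r}"
    using dim_ker_less kernel_dim_attained by (fastforce simp: image_iff)
  moreover have "?C - {0} = (\<lambda>a. a v* G) ` (- {0})" using zero by (auto simp: C)
  ultimately have weights: "nonzero_weights ?C = w ` {..<r}"
    by (simp only: nonzero_weights_def image_image hw flip: \<open>?\<kappa> ` (- {0}) = {..<r}\<close>)

  \<comment> \<open>Since \<open>j < n\<close>, the truncated subtraction in \<open>w\<close> is exact, and \<open>w\<close> decreases.\<close>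
  have w_less: "w j < w i" if "i < j" "j < r" for i j
    using theta_less[OF q_gt_1, of i j] theta_less[OF q_gt_1, of j n] that r_le_n
    by (simp add: assms(9,10) card_linear_set_U)
  have inj_w: "inj_on w {..<r}"
    by (rule linorder_inj_onI) (auto dest: w_less)
  \<comment> \<open>Positivity separates these weights from that of the zero codeword, which the enumerator counts by the term \<open>1\<close>.\<close>
  have w_bounds: "w i \<in> {1..CARD('m)}" if "i < r" for i
  proof -
    have "CARD('m) = N"
      using assms(8,9) bij_betw_same_card by (auto simp: represents_points_def)
    moreover have "0 < w i"
      using theta_less[OF q_gt_1, of i n] that r_le_n by (simp add: assms(9,10) card_linear_set_U)
    ultimately show ?thesis using assms(10) by simp
  qed

  have count: "card {c \<in> ?C. hamming_weight c = w i} = kernel_count i" if i: "i < r" for i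
  proof -
    have "{c \<in> ?C. hamming_weight c = w i} = (\<lambda>a. a v* G) ` {a. a \<noteq> 0 \<and> ?\<kappa> a = i}"
    proof -
      have "w (?\<kappa> a) = w i \<longleftrightarrow> a \<noteq> 0 \<and> ?\<kappa> a = i" for a
      proof (cases "a = 0")
        case True
        have "hamming_weight (0 :: 'f ^ 'm) = 0" by (simp add: hamming_weight_def)
        then have "w (?\<kappa> 0) = 0" using hw[of 0] by simp
        then show ?thesis using True w_bounds[OF i] by simp
      next
        case False
        then show ?thesis using inj_onD[OF inj_w] i dim_ker_less[OF False] by auto
      qed
      then have "hamming_weight (a v* G) = w i \<longleftrightarrow> a \<noteq> 0 \<and> ?\<kappa> a = i" for a
        by (simp only: hw)
      then show ?thesis unfolding C by blast
    qed
    then show ?thesis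
      using inj by (simp add: card_image inj_on_subset kernel_count_def)
  qed
  have A: "real (kernel_count i) = A (n - i)" if "i < r" for i
  proof -
    \<comment> \<open>The index \<open>d + l\<close> of \<open>A\<close> is the rank \<open>n - i\<close> when \<open>l = r - 1 - i\<close>.\<close>
    have l: "r - 1 - (r - 1 - i) = i" "d + (r - 1 - i) = n - i" "r - 1 - i + d = n - i"
      "r - 1 - i \<in> {0..n - d}" "r - 1 - i < r"
      using that r_le_n assms(11) by auto
    show ?thesis
      using assms(12)[OF l(4)] kernel_count_formula[OF l(5)] unfolding l by simp
  qed
  have "(\<Sum>j = 1..CARD('m). monom (real (card {c \<in> ?C. hamming_weight c = j})) j)
      = (\<Sum>j\<in>w ` {..<r}. monom (real (card {c \<in> ?C. hamming_weight c = j})) j)"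
  proof (rule sum.mono_neutral_right)
    show "\<forall>j\<in>{1..CARD('m)} - w ` {..<r}. monom (real (card {c \<in> ?C. hamming_weight c = j})) j = 0"
    proof
      fix j assume j: "j \<in> {1..CARD('m)} - w ` {..<r}"
      have "hamming_weight c \<noteq> j" if "c \<in> ?C" for c
      proof (cases "c = 0")
        case True
        then show ?thesis using j by (auto simp: hamming_weight_def)
      next
        case False
        then have "hamming_weight c \<in> nonzero_weights ?C" using that by (auto simp: nonzero_weights_def)
        then show ?thesis using j weights by auto
      qed
      then have "{c \<in> ?C. hamming_weight c = j} = {}" by auto
      then show "monom (real (card {c \<in> ?C. hamming_weight c = j})) j = 0" by simp
    qed
  qed (use w_bounds in auto)
  also have "\<dots> = (\<Sum>i<r. monom (A (n - i)) (w i))"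
    by (simp add: sum.reindex[OF inj_w] count A)
  finally have enumerator: "weight_enumerator ?C = 1 + (\<Sum>i<r. monom (A (n - i)) (w i))"
    by (simp add: weight_enumerator_def)

  have "weight_code r ?C"
    using weights by (simp add: weight_code_def card_image[OF inj_w])
      (simp add: generated_code_def vec.subspace_span)
  then show ?thesis using number weights enumerator r_range by simp
qed

end
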